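(* There exists a universal constant $A>0$ such that for every integer $n\ge1$ and every $1\le p\le\infty$, the unit ball $B_p^{2n}$ of $\ell_p^{2n}$ satisfies $$\frac{c^Z_{lin}(B_p^{2n})}{c(B^{2n})}\le A\left(\frac{\mathrm{Vol}(B_p^{2n})}{\mathrm{Vol}(B^{2n})}\right)^{1/n}.$$
   Context: $\mathbb{R}^{2n}$ has coordinates $(x_1,y_1,\ldots,x_n,y_n)$, the standard symplectic form $\omega_{st}=\sum_{j=1}^n dx_j\wedge dy_j$ and the standard inner product. $B^{2n}$ is the open Euclidean unit ball in $\mathbb{R}^{2n}$, $B^{2k}(r)$ is the open ball of radius $r$ in $\mathbb{R}^{2k}$, and $Z^{2n}(r)=B^2(r)\times\mathbb{R}^{2n-2}$, where the factor $B^2(r)$ is in the $(x_1,y_1)$-plane. $\mathrm{Sp}(\mathbb{R}^{2n})$ is the group of linear maps of $\mathbb{R}^{2n}$ preserving $\omega_{st}$. The linearized cylindrical capacity of $U\subset\mathbb{R}^{2n}$ is $$c^Z_{lin}(U)=\inf\{\pi r^2 : \text{there exists }\psi\in\mathrm{Sp}(\mathbb{R}^{2n})\text{ with }\psi(U)\subset Z^{2n}(r)\}.$$ The quantity $c(B^{2n})$ is the common value $\pi$ taken on $B^{2n}$ by all (normalized) symplectic capacities $c$. $\ell_p^{2n}$ is $\mathbb{R}^{2n}$, with the coordinates $(x_1,y_1,\ldots,x_n,y_n)$ written in this order as $z_1,\ldots,z_{2n}$, with norm $\left(\sum_{i=1}^{2n}|z_i|^p\right)^{1/p}$ for $p<\infty$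 and $\max_i|z_i|$ for $p=\infty$; $B_p^{2n}$ is its unit ball. $\mathrm{Vol}$ is Lebesgue measure. Here a universal constant depends neither on $n$ nor on $p$. *)

theory Defs
  imports "HOL-Analysis.Analysis"
begin

text \<open>
  The dimension has to be quantified inside the statement (the constant is independent of it), so
  \<open>\<real>\<^bsup>2n\<^esup>\<close> is the set of extensional functions on the index set \<open>{..<2*n}\<close>, which is also
  the space of the product measure used for the volume. Indices start at 0: the coordinates
  \<open>x\<^sub>j, y\<^sub>j\<close> (\<open>1 \<le> j \<le> n\<close>) of \<open>u\<close> are \<open>u (2*(j-1))\<close> and \<open>u (2*(j-1)+1)\<close>.
\<close>

definition R2n :: "nat \<Rightarrow> (nat \<Rightarrow> real) set" where
  "R2n n = {..<2*n} \<rightarrow>\<^sub>E UNIV"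

definition vadd :: "nat \<Rightarrow> (nat \<Rightarrow> real) \<Rightarrow> (nat \<Rightarrow> real) \<Rightarrow> (nat \<Rightarrow> real)" where
  "vadd n u v = (\<lambda>i\<in>{..<2*n}. u i + v i)"

definition vscale :: "nat \<Rightarrow> real \<Rightarrow> (nat \<Rightarrow> real) \<Rightarrow> (nat \<Rightarrow> real)" where
  "vscale n a u = (\<lambda>i\<in>{..<2*n}. a * u i)"

definition linear_maps :: "nat \<Rightarrow> ((nat \<Rightarrow> real) \<Rightarrow> (nat \<Rightarrow> real)) set" where
  "linear_maps n = {\<psi> \<in> R2n n \<rightarrow>\<^sub>E R2n n.
     (\<forall>u\<in>R2n n. \<forall>v\<in>R2n n. \<psi> (vadd n u v) = vadd n (\<psi> u) (\<psi> v)) \<and>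
     (\<forall>a. \<forall>u\<in>R2n n. \<psi> (vscale n a u) = vscale n a (\<psi> u))}"

definition omega_st :: "nat \<Rightarrow> (nat \<Rightarrow> real) \<Rightarrow> (nat \<Rightarrow> real) \<Rightarrow> real" where
  "omega_st n u v = (\<Sum>j<n. u (2*j) * v (2*j+1) - u (2*j+1) * v (2*j))"

definition Sp :: "nat \<Rightarrow> ((nat \<Rightarrow> real) \<Rightarrow> (nat \<Rightarrow> real)) set" where
  "Sp n = {\<psi> \<in> linear_maps n.
     \<forall>u\<in>R2n n. \<forall>v\<in>R2n n. omega_st n (\<psi> u) (\<psi> v) = omega_st n u v}"

definition ball2n :: "nat \<Rightarrow> real \<Rightarrow> (nat \<Rightarrow> real) set" where
  "ball2n n r = {u \<in> R2n n. L2_set u {..<2*n} < r}"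

definition cyl2n :: "nat \<Rightarrow> real \<Rightarrow> (nat \<Rightarrow> real) set" where
  "cyl2n n r = {u \<in> R2n n. restrict u {..<2} \<in> ball2n 1 r}"

text \<open>The value is \<open>\<infinity>\<close> if no linear symplectic image of \<open>U\<close> lies in a cylinder.\<close>

definition cZ_lin :: "nat \<Rightarrow> (nat \<Rightarrow> real) set \<Rightarrow> ennreal" where
  "cZ_lin n U = Inf {ennreal (pi * r\<^sup>2) | r. 0 < r \<and> (\<exists>\<psi>\<in>Sp n. \<psi> ` U \<subseteq> cyl2n n r)}"

text \<open>
  The value \<open>c(B\<^bsup>2n\<^esup>)\<close> common to all symplectic capacities \<open>c\<close>, which is fixed by their
  normalization and does not depend on \<open>n\<close>.
\<close>

definition c_unit_ball :: ennreal where
  "c_unit_ball = ennreal pi"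

definition lp_norm :: "nat \<Rightarrow> ennreal \<Rightarrow> (nat \<Rightarrow> real) \<Rightarrow> real" where
  "lp_norm n p u =
     (if p = \<infinity> then Max ((\<lambda>i. \<bar>u i\<bar>) ` {..<2*n})
      else (\<Sum>i<2*n. \<bar>u i\<bar> powr enn2real p) powr (1 / enn2real p))"

text \<open>Open, so that the case \<open>p = 2\<close> is \<open>B\<^bsup>2n\<^esup>\<close>.\<close>

definition lp_ball :: "nat \<Rightarrow> ennreal \<Rightarrow> (nat \<Rightarrow> real) set" where
  "lp_ball n p = {u \<in> R2n n. lp_norm n p u < 1}"

definition Vol :: "nat \<Rightarrow> (nat \<Rightarrow> real) set \<Rightarrow> real" where
  "Vol n U = measure (completion (Pi\<^sub>M {..<2*n} (\<lambda>_. lborel))) U"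

end

theory Submission imports Defs begin

text \<open>
  Both sides are compared with \<open>n\<^bsup>1-2/p\<^esup>\<close>, so that the estimate holds for all \<open>p\<close> at once.

  \<^emph>\<open>The capacity.\<close> By the power mean inequality the functionals
  \<open>(x\<^sub>1 + \<dots> + x\<^sub>n) / sqrt n\<close> and \<open>(y\<^sub>1 + \<dots> + y\<^sub>n) / sqrt n\<close> are bounded by \<open>n\<^bsup>1/2-1/p\<^esup>\<close> on
  \<open>B\<^sub>p\<close>. They are a conjugate pair, so they are the first two coordinates of some linear
  symplectic map; here it is the complexification of the reflection of \<open>\<real>\<^bsup>n\<^esup>\<close> that exchanges
  \<open>e\<^sub>1\<close> with the unit vector on the diagonal. This map sends \<open>B\<^sub>p\<close> into a cylinder with
  \<open>r\<^sup>2 = 2 n\<^bsup>1-2/p\<^esup>\<close> (\<open>cZ_lin_lp_ball_le\<close>).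

  \<^emph>\<open>The volume.\<close> Up to a factor exponential in \<open>n\<close>, which the \<open>n\<close>-th root makes harmless,
  \<open>B\<^sub>p\<close> has the volume of its inscribed cube with vertices \<open>(\<plusminus>(2n)\<^bsup>-1/p\<^esup>, \<dots>)\<close>. Only the lower
  bound by the cube enters; together with
  \<open>Vol B\<^bsup>2n\<^esup> = \<pi>\<^bsup>n\<^esup> / n! \<le> (e \<pi> / n)\<^bsup>n\<^esup>\<close> this bounds the volume ratio from below
  (\<open>volume_ratio_ge\<close>). The resulting constant is \<open>2 e \<pi>\<close>.
\<close>

section \<open>Power means and the \<open>\<ell>\<^sub>p\<close> norm\<close>

text \<open>
  Young's inequality compares each \<open>\<bar>x i\<bar> powr p\<close> with the mean \<open>S / k\<close> of these powers; adding
  up the comparisons gives the bound with its sharp constant.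
\<close>
lemma sum_abs_le_power_mean:
  fixes x :: "'a \<Rightarrow> real" and p :: real
  assumes "finite J" "J \<noteq> {}" "1 \<le> p"
  shows "(\<Sum>i\<in>J. \<bar>x i\<bar>)
           \<le> real (card J) powr (1 - 1 / p) * (\<Sum>i\<in>J. \<bar>x i\<bar> powr p) powr (1 / p)"
proof -
  define S where "S = (\<Sum>i\<in>J. \<bar>x i\<bar> powr p)"
  define k where "k = real (card J)"
  have k: "k > 0" using assms by (simp add: k_def card_gt_0_iff)
  have S0: "S \<ge> 0" by (simp add: S_def sum_nonneg)
  show ?thesis
  proof (cases "S = 0")
    case True
    then have "\<forall>i\<in>J. \<bar>x i\<bar> powr p = 0"
      using assms(1) by (simp add: S_def sum_nonneg_eq_0_iff)
    then have "\<forall>i\<in>J. \<bar>x i\<bar> = 0" by simp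
    then show ?thesis by simp
  next
    case False
    with S0 have S: "S > 0" by simp
    have young: "\<bar>x i\<bar> * (S / k) powr (1 - 1 / p)
        \<le> (1 / p) * \<bar>x i\<bar> powr p + (1 - 1 / p) * (S / k)" for i
    proof (cases "x i = 0")
      case True
      then show ?thesis using assms(3) S k by simp
    next
      case False
      have "(\<bar>x i\<bar> powr p) powr (1 / p) = \<bar>x i\<bar>"
        using assms(3) by (simp add: powr_powr)
      moreover have "(\<bar>x i\<bar> powr p) powr (1 / p) * (S / k) powr (1 - 1 / p)
          \<le> (1 / p) * \<bar>x i\<bar> powr p + (1 - 1 / p) * (S / k)"
        using assms(3) S k False by (intro Youngs_inequality_0) auto
      ultimately show ?thesis by simp
    qed
    have "(\<Sum>i\<in>J. \<bar>x i\<bar>) * (S / k) powr (1 - 1 / p)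
        \<le> (\<Sum>i\<in>J. (1 / p) * \<bar>x i\<bar> powr p + (1 - 1 / p) * (S / k))"
      unfolding sum_distrib_right by (intro sum_mono young)
    also have "\<dots> = (1 / p) * S + k * ((1 - 1 / p) * (S / k))"
      by (simp add: sum.distrib S_def k_def sum_distrib_left)
    also have "\<dots> = S"
      using k by (simp add: algebra_simps)
    also have "S = (k powr (1 - 1 / p) * S powr (1 / p)) * (S / k) powr (1 - 1 / p)"
    proof -
      have "S powr (1 / p) * S powr (1 - 1 / p) = S"
        using S by (simp flip: powr_add)
      then show ?thesis using S k by (simp add: powr_divide)
    qed
    finally show ?thesis
      using S k unfolding S_def[symmetric] k_def[symmetric] by simp
  qed
qed

lemma one_le_enn2real:
  assumes "1 \<le> p" "p \<noteq> \<infinity>"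
  shows "1 \<le> enn2real p"
  using assms by (metis enn2real_1 enn2real_mono infinity_ennreal_def top.not_eq_extremum)

text \<open>
  Monotonicity in the index set turns the power mean inequality into a bound on partial sums. The
  case \<open>p = \<infinity>\<close> has the same shape because \<open>1 / enn2real \<infinity> = 1 / 0 = 0\<close>; from here on
  \<open>1 / enn2real p\<close> is the exponent \<open>1/p\<close> for every \<open>p\<close>.
\<close>
lemma sum_abs_le_lp_norm:
  assumes p: "1 \<le> p" and J: "J \<subseteq> {..<2*n}" "J \<noteq> {}"
  shows "(\<Sum>i\<in>J. \<bar>u i\<bar>) \<le> real (card J) powr (1 - 1 / enn2real p) * lp_norm n p u"
proof -
  have fin: "finite J" using J finite_subset by blast
  then have card: "card J > 0" using J by (simp add: card_gt_0_iff)
  show ?thesis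
  proof (cases "p = \<infinity>")
    case True
    have "\<bar>u i\<bar> \<le> lp_norm n p u" if "i \<in> J" for i
      using that J True by (auto simp: lp_norm_def intro!: Max_ge)
    then have "(\<Sum>i\<in>J. \<bar>u i\<bar>) \<le> real (card J) * lp_norm n p u"
      by (intro sum_bounded_above) auto
    then show ?thesis using card True by simp
  next
    case False
    define q where "q = enn2real p"
    have q: "1 \<le> q"
      unfolding q_def using p False by (rule one_le_enn2real)
    have "(\<Sum>i\<in>J. \<bar>u i\<bar> powr q) \<le> (\<Sum>i<2*n. \<bar>u i\<bar> powr q)"
      using J by (intro sum_mono2) auto
    then have "(\<Sum>i\<in>J. \<bar>u i\<bar> powr q) powr (1 / q) \<le> lp_norm n p u"
      using False q by (auto simp: lp_norm_def q_def sum_nonneg intro!: powr_mono2)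
    then have "real (card J) powr (1 - 1 / q) * (\<Sum>i\<in>J. \<bar>u i\<bar> powr q) powr (1 / q)
        \<le> real (card J) powr (1 - 1 / q) * lp_norm n p u"
      by (intro mult_left_mono) auto
    then show ?thesis
      using sum_abs_le_power_mean[OF fin J(2) q, of u] unfolding q_def by linarith
  qed
qed

corollary abs_le_lp_norm:
  assumes "1 \<le> p" "i < 2*n"
  shows "\<bar>u i\<bar> \<le> lp_norm n p u"
  using sum_abs_le_lp_norm[OF assms(1), of "{i}" n u] assms(2) by simp

section \<open>Volumes\<close>

lemma sets_lp_ball:
  assumes "n \<ge> 1"
  shows "lp_ball n p \<in> sets (Pi\<^sub>M {..<2*n} (\<lambda>_. lborel))"
proof -
  have "lp_norm n p \<in> borel_measurable (Pi\<^sub>M {..<2*n} (\<lambda>_. lborel))"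
  proof (cases "p = \<infinity>")
    case True
    have "(\<lambda>u. Max ((\<lambda>i. \<bar>u i\<bar>) ` {..<2*n})) \<in> borel_measurable (Pi\<^sub>M {..<2*n} (\<lambda>_. lborel :: real measure))"
      by (intro borel_measurable_Max) auto
    then show ?thesis using True by (simp add: lp_norm_def[abs_def])
  next
    case False
    then show ?thesis by (simp add: lp_norm_def[abs_def])
  qed
  then have "{u \<in> space (Pi\<^sub>M {..<2*n} (\<lambda>_. lborel)). lp_norm n p u < 1}
      \<in> sets (Pi\<^sub>M {..<2*n} (\<lambda>_. lborel))"
    by measurable
  then show ?thesis by (simp add: lp_ball_def R2n_def space_PiM)
qed

text \<open>
  The finiteness assumption guards against \<open>measure\<close>, and hence \<open>Vol\<close>, being \<open>0\<close> on sets of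
  infinite measure.
\<close>
lemma Vol_mono:
  assumes "A \<subseteq> B" and A: "A \<in> sets (Pi\<^sub>M {..<2*n} (\<lambda>_. lborel))"
    and B: "B \<in> sets (Pi\<^sub>M {..<2*n} (\<lambda>_. lborel))"
    and "emeasure (Pi\<^sub>M {..<2*n} (\<lambda>_. lborel)) B < \<infinity>"
  shows "Vol n A \<le> Vol n B"
  unfolding Vol_def measure_completion[OF A] measure_completion[OF B]
  using assms by (intro measure_mono_fmeasurable) (auto simp: fmeasurable_def)

lemma emeasure_open_cube:
  fixes a :: real
  assumes "0 < a"
  shows "emeasure (Pi\<^sub>M {..<2*n} (\<lambda>_. lborel)) ({..<2*n} \<rightarrow>\<^sub>E {-a<..<a}) = ennreal ((2 * a) ^ (2*n))"
proof -
  interpret product_sigma_finite "\<lambda>_::nat. lborel :: real measure" by standard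
  show ?thesis
    using assms by (subst emeasure_PiM) (simp_all add: prod_ennreal ennreal_power)
qed

lemma sets_open_cube:
  fixes a :: real
  shows "({..<2*n::nat} \<rightarrow>\<^sub>E {-a<..<a}) \<in> sets (Pi\<^sub>M {..<2*n} (\<lambda>_. lborel))"
  by (intro sets_PiM_I_finite) auto

lemma Vol_open_cube:
  fixes a :: real
  assumes "0 < a"
  shows "Vol n ({..<2*n} \<rightarrow>\<^sub>E {-a<..<a}) = (2 * a) ^ (2*n)"
  using assms emeasure_open_cube[OF assms, of n]
  by (simp add: Vol_def measure_completion[OF sets_open_cube] measure_def)

lemma emeasure_lp_ball_finite:
  assumes "n \<ge> 1" "1 \<le> p"
  shows "emeasure (Pi\<^sub>M {..<2*n} (\<lambda>_. lborel)) (lp_ball n p) < \<infinity>"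
proof -
  have "lp_ball n p \<subseteq> {..<2*n} \<rightarrow>\<^sub>E {-1<..<1}"
  proof
    fix u assume u: "u \<in> lp_ball n p"
    have "\<bar>u i\<bar> < 1" if "i < 2*n" for i
      using abs_le_lp_norm[OF assms(2) that, of u] u by (auto simp: lp_ball_def)
    then show "u \<in> {..<2*n} \<rightarrow>\<^sub>E {-1<..<1}"
      using u by (auto simp: lp_ball_def R2n_def PiE_iff abs_less_iff minus_less_iff)
  qed
  then have "emeasure (Pi\<^sub>M {..<2*n} (\<lambda>_. lborel)) (lp_ball n p)
      \<le> emeasure (Pi\<^sub>M {..<2*n} (\<lambda>_. lborel)) ({..<2*n} \<rightarrow>\<^sub>E {-1<..<1::real})"
    by (intro emeasure_mono sets_open_cube)
  also have "\<dots> < \<infinity>"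
    using emeasure_open_cube[of 1 n] by (simp add: ennreal_less_top)
  finally show ?thesis .
qed

lemma open_cube_subset_lp_ball:
  assumes n: "n \<ge> 1" and p: "1 \<le> p"
  defines "a \<equiv> real (2*n) powr (- 1 / enn2real p)"
  shows "({..<2*n} \<rightarrow>\<^sub>E {-a<..<a}) \<subseteq> lp_ball n p"
proof
  fix u assume u: "u \<in> {..<2*n} \<rightarrow>\<^sub>E {-a<..<a}"
  then have ua: "\<bar>u i\<bar> < a" if "i < 2*n" for i
    using that by (auto simp: PiE_iff abs_less_iff minus_less_iff)
  have "lp_norm n p u < 1"
  proof (cases "p = \<infinity>")
    case True
    then have "a = 1" using n by (simp add: a_def)
    then show ?thesis using ua n True by (auto simp: lp_norm_def lessThan_empty_iff)
  next
    case False
    define q where "q = enn2real p"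
    have q: "1 \<le> q"
      unfolding q_def using p False by (rule one_le_enn2real)
    have aq: "a powr q = 1 / real (2*n)"
    proof -
      have "a powr q = real (2*n) powr (- 1)"
        using q unfolding a_def q_def[symmetric] powr_powr by simp
      then show ?thesis using n by (simp add: powr_minus_divide)
    qed
    have "(\<Sum>i<2*n. \<bar>u i\<bar> powr q) < (\<Sum>i<2*n. a powr q)"
      using ua q n by (intro sum_strict_mono powr_less_mono2) (auto simp: lessThan_empty_iff)
    also have "\<dots> = 1" using n by (simp add: aq)
    finally have "(\<Sum>i<2*n. \<bar>u i\<bar> powr q) powr (1 / q) < 1 powr (1 / q)"
      using q by (intro powr_less_mono2) (auto simp: sum_nonneg)
    then show ?thesis using False by (simp add: lp_norm_def q_def)
  qed
  then show "u \<in> lp_ball n p"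
    using u by (auto simp: lp_ball_def R2n_def PiE_iff)
qed

lemma Vol_lp_ball_ge:
  assumes "n \<ge> 1" "1 \<le> p"
  shows "(2 * real (2*n) powr (- 1 / enn2real p)) ^ (2*n) \<le> Vol n (lp_ball n p)"
proof -
  have a: "0 < real (2*n) powr (- 1 / enn2real p)" using assms by simp
  show ?thesis
    unfolding Vol_open_cube[OF a, symmetric]
    using assms
    by (intro Vol_mono open_cube_subset_lp_ball sets_open_cube sets_lp_ball emeasure_lp_ball_finite)
qed

lemma ball2n_eq_lp_ball: "ball2n n 1 = lp_ball n 2"
  by (simp add: ball2n_def lp_ball_def lp_norm_def L2_set_def powr_half_sqrt sum_nonneg)

text \<open>The left side over \<open>n!\<close> is a single term of the exponential series at \<open>n\<close>.\<close>
lemma power_le_exp_fact: "real n ^ n \<le> exp (real n) * fact n"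
proof -
  have "real n ^ n /\<^sub>R fact n = (\<Sum>k\<in>{n}. real n ^ k /\<^sub>R fact k)" by simp
  also have "\<dots> \<le> (\<Sum>k. real n ^ k /\<^sub>R fact k)"
    by (intro sum_le_suminf summable_exp_generic) auto
  finally show ?thesis
    by (simp add: exp_def field_simps)
qed

lemma Vol_ball2n:
  assumes "n \<ge> 1"
  shows "0 < Vol n (ball2n n 1)" and "Vol n (ball2n n 1) \<le> (exp 1 * pi / real n) ^ n"
proof -
  let ?M = "Pi\<^sub>M {..<2*n} (\<lambda>_. lborel :: real measure)"
  let ?C = "{f. sqrt (\<Sum>i\<in>{..<2*n}. (f i)\<^sup>2) \<le> 1} \<inter> space ?M"
  have p2: "1 \<le> (2::ennreal)" by simp
  have "0 < (2 * real (2*n) powr (- 1 / enn2real 2)) ^ (2*n)" using assms by simp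
  also have "\<dots> \<le> Vol n (ball2n n 1)"
    unfolding ball2n_eq_lp_ball by (rule Vol_lp_ball_ge[OF assms p2])
  finally show "0 < Vol n (ball2n n 1)" .
  have em: "emeasure ?M ?C = ennreal (pi ^ n / fact n)"
    using emeasure_cball_aux[of "{..<2*n}" 1] unit_ball_vol_even[of n] by simp
  have C: "?C \<in> sets ?M" by measurable
  have "Vol n (ball2n n 1) \<le> Vol n ?C"
  proof (rule Vol_mono[OF _ _ C])
    show "ball2n n 1 \<subseteq> ?C"
      by (rule subsetI) (simp add: ball2n_def R2n_def space_PiM L2_set_def)
    show "ball2n n 1 \<in> sets ?M"
      unfolding ball2n_eq_lp_ball using assms by (rule sets_lp_ball)
    show "emeasure ?M ?C < \<infinity>" unfolding em by (simp add: ennreal_less_top)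
  qed
  also have "\<dots> = pi ^ n / fact n"
    using em by (simp add: Vol_def measure_completion[OF C] measure_def)
  also have "\<dots> \<le> (exp 1 * pi / real n) ^ n"
    using power_le_exp_fact[of n] assms
    by (simp add: field_simps power_mult_distrib power_divide flip: exp_of_nat_mult)
  finally show "Vol n (ball2n n 1) \<le> (exp 1 * pi / real n) ^ n" .
qed

text \<open>
  The cube has volume \<open>(2 (2n)\<^bsup>-1/p\<^esup>)\<^bsup>2n\<^esup>\<close>, so the \<open>n\<close>-th root of the ratio is at least
  \<open>4 (2n)\<^bsup>-2/p\<^esup> n / (e \<pi>) = 2\<^bsup>2-2/p\<^esup> n\<^bsup>1-2/p\<^esup> / (e \<pi>)\<close>, and \<open>p \<ge> 1\<close> bounds the power of \<open>2\<close> below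
  by \<open>1\<close>.
\<close>
lemma volume_ratio_ge:
  assumes n: "n \<ge> 1" and p: "1 \<le> p"
  shows "real n powr (1 - 2 / enn2real p)
    \<le> exp 1 * pi * (Vol n (lp_ball n p) / Vol n (ball2n n 1)) powr (1 / real n)"
proof -
  define t where "t = 1 / enn2real p"
  have t: "t \<le> 1"
  proof (cases "p = \<infinity>")
    case False
    then have "1 \<le> enn2real p"
      using p by (intro one_le_enn2real)
    then show ?thesis by (simp add: t_def)
  qed (simp add: t_def)
  define y where "y = (2 * real (2*n) powr (- t))\<^sup>2 / (exp 1 * pi / real n)"
  have y: "y > 0" using n by (simp add: y_def)
  have "y ^ n = (2 * real (2*n) powr (- t)) ^ (2*n) / (exp 1 * pi / real n) ^ n"
    by (simp only: y_def power_divide power_mult)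
  also have "\<dots> \<le> Vol n (lp_ball n p) / Vol n (ball2n n 1)"
    using Vol_lp_ball_ge[OF n p] Vol_ball2n[OF n] n
    by (intro frac_le) (simp_all add: t_def Vol_def)
  finally have "(y ^ n) powr (1 / real n)
      \<le> (Vol n (lp_ball n p) / Vol n (ball2n n 1)) powr (1 / real n)"
    using y by (intro powr_mono2) auto
  moreover have "(y ^ n) powr (1 / real n) = y"
    using y n by (simp add: powr_powr flip: powr_realpow)
  ultimately have le: "y \<le> (Vol n (lp_ball n p) / Vol n (ball2n n 1)) powr (1 / real n)"
    by simp
  have "1 \<le> 2 powr (2 - 2 * t)" using t by (intro ge_one_powr_ge_zero) auto
  then have "real n powr (1 - 2 * t) \<le> 2 powr (2 - 2 * t) * real n powr (1 - 2 * t)"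
    using n by simp
  also have "\<dots> = exp 1 * pi * y"
    using n
    by (simp add: y_def power_mult_distrib powr_mult powr_diff powr_minus power2_eq_square
        field_simps flip: powr_add)
  also have "\<dots> \<le> exp 1 * pi * (Vol n (lp_ball n p) / Vol n (ball2n n 1)) powr (1 / real n)"
    using le by (intro mult_left_mono) auto
  finally show ?thesis by (simp add: t_def)
qed

section \<open>A unitary map squeezing the \<open>\<ell>\<^sub>p\<close> ball into a cylinder\<close>

text \<open>
  The Householder reflection in the hyperplane orthogonal to \<open>w = e\<^sub>1 - (1, \<dots>, 1) / sqrt n\<close>, for
  which \<open>\<bar>w\<bar>\<^sup>2 / 2 = 1 - 1 / sqrt n\<close>. For \<open>n = 1\<close> the vector \<open>w\<close> vanishes, and
  division by zero makes the formula the identity.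
\<close>
definition diag_reflection :: "nat \<Rightarrow> (nat \<Rightarrow> real) \<Rightarrow> nat \<Rightarrow> real" where
  "diag_reflection n x =
     (let w = (\<lambda>j. (if j = 0 then 1 else 0) - 1 / sqrt n)
      in (\<lambda>j. x j - (\<Sum>k<n. w k * x k) / (1 - 1 / sqrt n) * w j))"

lemma diag_reflection_0:
  assumes "n \<ge> 1"
  shows "diag_reflection n x 0 = (\<Sum>k<n. x k) / sqrt n"
proof (cases "n = 1")
  case True
  then show ?thesis by (simp add: diag_reflection_def)
next
  case False
  then have "1 - 1 / sqrt n \<noteq> 0" using assms by simp
  moreover have "(\<Sum>k<n. ((if k = 0 then 1 else 0) - 1 / sqrt n) * x k)
      = x 0 - (\<Sum>k<n. x k) / sqrt n"
    using assms
    by (simp add: left_diff_distrib sum_subtractf sum_divide_distrib if_distrib[of "\<lambda>c. c * _"] sum.delta' cong: if_cong)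
  ultimately show ?thesis by (simp add: diag_reflection_def Let_def)
qed

lemma diag_reflection_inner:
  assumes "n \<ge> 1"
  shows "(\<Sum>j<n. diag_reflection n x j * diag_reflection n y j) = (\<Sum>j<n. x j * y j)"
proof -
  define w where "w j = (if j = 0 then 1 else 0) - 1 / sqrt n" for j :: nat
  define c where "c = 1 / (1 - 1 / sqrt n)"
  define X where "X = (\<Sum>k<n. w k * x k)"
  define Y where "Y = (\<Sum>k<n. w k * y k)"
  have refl: "diag_reflection n x j = x j - c * X * w j" "diag_reflection n y j = y j - c * Y * w j" for j
    by (simp_all add: diag_reflection_def w_def c_def X_def Y_def)
  have "(\<Sum>j<n. (w j)\<^sup>2) = (\<Sum>j<n. (if j = 0 then 1 - 2 / sqrt n else 0) + 1 / n)"
    by (intro sum.cong) (auto simp: w_def power2_eq_square field_simps)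
  also have "\<dots> = 2 * (1 - 1 / sqrt n)"
    using assms by (simp add: sum.distrib)
  finally have ww: "(\<Sum>j<n. (w j)\<^sup>2) = 2 * (1 - 1 / sqrt n)" .
  have "(\<Sum>j<n. diag_reflection n x j * diag_reflection n y j)
      = (\<Sum>j<n. x j * y j - c * Y * (w j * x j) - c * X * (w j * y j) + c * c * X * Y * (w j)\<^sup>2)"
    by (intro sum.cong) (auto simp: refl algebra_simps power2_eq_square)
  also have "\<dots> = (\<Sum>j<n. x j * y j) - 2 * c * X * Y + c * c * X * Y * (\<Sum>j<n. (w j)\<^sup>2)"
    by (simp add: sum.distrib sum_subtractf X_def Y_def flip: sum_distrib_left)
  also have "c * c * X * Y * (\<Sum>j<n. (w j)\<^sup>2) = 2 * c * X * Y"
  proof -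
    have "1 / d * (1 / d) * (2 * d) = 2 * (1 / d)" for d :: real by simp
    then have "c * c * (2 * (1 - 1 / sqrt n)) = 2 * c" unfolding c_def .
    then show ?thesis unfolding ww by (metis mult.assoc mult.commute)
  qed
  finally show ?thesis by simp
qed

lemma diag_reflection_add:
  "diag_reflection n (\<lambda>j. x j + y j) j = diag_reflection n x j + diag_reflection n y j"
  by (simp add: diag_reflection_def Let_def sum.distrib distrib_left add_divide_distrib distrib_right)

lemma diag_reflection_scale:
  "diag_reflection n (\<lambda>j. a * x j) j = a * diag_reflection n x j"
  by (simp add: diag_reflection_def Let_def mult.left_commute[of _ a] right_diff_distrib
      flip: sum_distrib_left)

lemma diag_reflection_cong:
  assumes "\<And>k. k < n \<Longrightarrow> x k = y k" "j < n"
  shows "diag_reflection n x j = diag_reflection n y j"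
  using assms by (simp add: diag_reflection_def)

text \<open>
  The reflection acts on the \<open>x\<close> and on the \<open>y\<close> coordinates separately. These are the even and
  the odd indices, so \<open>i mod 2\<close> selects the part and \<open>i div 2\<close> the position in it.
\<close>
definition diag_unitary :: "nat \<Rightarrow> (nat \<Rightarrow> real) \<Rightarrow> nat \<Rightarrow> real" where
  "diag_unitary n =
     (\<lambda>u\<in>R2n n. \<lambda>i\<in>{..<2*n}. diag_reflection n (\<lambda>j. u (2*j + i mod 2)) (i div 2))"

lemma diag_unitary_even_odd:
  assumes "u \<in> R2n n" "j < n"
  shows "diag_unitary n u (2*j) = diag_reflection n (\<lambda>j. u (2*j)) j"
    and "diag_unitary n u (2*j+1) = diag_reflection n (\<lambda>j. u (2*j+1)) j"
  using assms by (simp_all add: diag_unitary_def)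

text \<open>
  \<open>\<omega>\<close> is a difference of inner products of an \<open>x\<close> part with a \<open>y\<close> part, and the reflection
  preserves these.
\<close>
lemma diag_unitary_Sp:
  assumes "n \<ge> 1"
  shows "diag_unitary n \<in> Sp n"
proof -
  have mem: "diag_unitary n \<in> R2n n \<rightarrow>\<^sub>E R2n n"
    by (auto simp: diag_unitary_def R2n_def)
  have idx: "2 * k + i mod 2 < 2 * n" if "k < n" for k i :: nat
    using that by linarith
  have add: "diag_unitary n (vadd n u v) = vadd n (diag_unitary n u) (diag_unitary n v)"
    if "u \<in> R2n n" "v \<in> R2n n" for u v
  proof
    fix i
    have "diag_reflection n (\<lambda>j. vadd n u v (2*j + i mod 2)) (i div 2)
        = diag_reflection n (\<lambda>j. u (2*j + i mod 2) + v (2*j + i mod 2)) (i div 2)" if "i < 2*n"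
      using that idx by (intro diag_reflection_cong) (auto simp: vadd_def)
    moreover have "vadd n u v \<in> R2n n" by (auto simp: vadd_def R2n_def)
    ultimately show "diag_unitary n (vadd n u v) i = vadd n (diag_unitary n u) (diag_unitary n v) i"
      using that by (auto simp: diag_unitary_def diag_reflection_add vadd_def)
  qed
  have scale: "diag_unitary n (vscale n a u) = vscale n a (diag_unitary n u)"
    if "u \<in> R2n n" for a u
  proof
    fix i
    have "diag_reflection n (\<lambda>j. vscale n a u (2*j + i mod 2)) (i div 2)
        = diag_reflection n (\<lambda>j. a * u (2*j + i mod 2)) (i div 2)" if "i < 2*n"
      using that idx by (intro diag_reflection_cong) (auto simp: vscale_def)
    moreover have "vscale n a u \<in> R2n n" by (auto simp: vscale_def R2n_def)
    ultimately show "diag_unitary n (vscale n a u) i = vscale n a (diag_unitary n u) i"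
      using that by (auto simp: diag_unitary_def diag_reflection_scale vscale_def)
  qed
  have omega: "omega_st n (diag_unitary n u) (diag_unitary n v) = omega_st n u v"
    if "u \<in> R2n n" "v \<in> R2n n" for u v
  proof -
    have "omega_st n (diag_unitary n u) (diag_unitary n v)
        = (\<Sum>j<n. diag_reflection n (\<lambda>j. u (2*j)) j * diag_reflection n (\<lambda>j. v (2*j+1)) j
             - diag_reflection n (\<lambda>j. u (2*j+1)) j * diag_reflection n (\<lambda>j. v (2*j)) j)"
      unfolding omega_st_def
      by (intro sum.cong) (simp_all only: lessThan_iff diag_unitary_even_odd that)
    then show ?thesis
      by (simp only: sum_subtractf diag_reflection_inner[OF assms] omega_st_def)
  qed
  show ?thesis
    unfolding Sp_def linear_maps_def using mem add scale omega by blast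
qed

text \<open>
  The first two coordinates of the image are the normalised sums of the \<open>x\<close> and of the \<open>y\<close>
  coordinates. Bounding each by \<open>n\<^bsup>1/2-1/p\<^esup>\<close> on its own costs the factor \<open>sqrt 2\<close>.
\<close>
lemma diag_unitary_lp_ball_subset_cyl:
  assumes n: "n \<ge> 1" and p: "1 \<le> p"
  defines "r \<equiv> sqrt 2 * real n powr (1/2 - 1 / enn2real p)"
  shows "diag_unitary n ` lp_ball n p \<subseteq> cyl2n n r"
proof
  fix v assume "v \<in> diag_unitary n ` lp_ball n p"
  then obtain u where u: "u \<in> R2n n" "lp_norm n p u < 1" and v: "v = diag_unitary n u"
    by (auto simp: lp_ball_def)
  define s where "s = real n powr (1/2 - 1 / enn2real p)"
  have s: "s > 0" using n by (simp add: s_def)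
  have bound: "\<bar>(\<Sum>j<n. u (2*j+e)) / sqrt n\<bar> < s" if "e < 2" for e :: nat
  proof -
    have inj: "inj_on (\<lambda>j. 2*j+e) {..<n}" by (auto simp: inj_on_def)
    let ?J = "(\<lambda>j. 2*j+e) ` {..<n}"
    have card: "card ?J = n" using card_image[OF inj] by simp
    have "\<bar>\<Sum>j<n. u (2*j+e)\<bar> \<le> (\<Sum>i\<in>?J. \<bar>u i\<bar>)"
      by (simp add: sum.reindex[OF inj])
    also have "\<dots> \<le> real n powr (1 - 1 / enn2real p) * lp_norm n p u"
      using sum_abs_le_lp_norm[OF p, of ?J n u] n that unfolding card
      by (fastforce simp: lessThan_empty_iff)
    also have "\<dots> < real n powr (1 - 1 / enn2real p)"
      using u n by simp
    also have "\<dots> = s * sqrt n"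
      using n by (simp add: s_def flip: powr_half_sqrt powr_add)
    finally show ?thesis using n by (simp add: pos_divide_less_eq)
  qed
  have "v 0 = (\<Sum>j<n. u (2*j+0)) / sqrt n" "v 1 = (\<Sum>j<n. u (2*j+1)) / sqrt n"
    using diag_unitary_even_odd[OF u(1), of 0] n by (simp_all add: v diag_reflection_0)
  then have "\<bar>v 0\<bar> < s" "\<bar>v 1\<bar> < s"
    using bound[of 0] bound[of 1] by simp_all
  then have "(v 0)\<^sup>2 < s\<^sup>2" "(v 1)\<^sup>2 < s\<^sup>2"
    using power_strict_mono[of "\<bar>v 0\<bar>" s 2] power_strict_mono[of "\<bar>v 1\<bar>" s 2] by simp_all
  then have "sqrt ((v 0)\<^sup>2 + (v 1)\<^sup>2) < sqrt (2 * s\<^sup>2)" by simp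
  also have "\<dots> = r" using s by (simp add: real_sqrt_mult r_def s_def)
  finally have "L2_set (restrict v {..<2}) {..<2} < r"
    by (simp add: L2_set_def lessThan_Suc numeral_2_eq_2 add.commute)
  moreover have "v \<in> R2n n" using u(1) by (simp add: v diag_unitary_def) (simp add: R2n_def)
  ultimately show "v \<in> cyl2n n r"
    by (simp add: cyl2n_def ball2n_def) (simp add: R2n_def)
qed

lemma cZ_lin_lp_ball_le:
  assumes n: "n \<ge> 1" and p: "1 \<le> p"
  shows "cZ_lin n (lp_ball n p) \<le> ennreal (pi * (2 * real n powr (1 - 2 / enn2real p)))"
proof -
  define r where "r = sqrt 2 * real n powr (1/2 - 1 / enn2real p)"
  have "r > 0" using n by (simp add: r_def)
  moreover have "r\<^sup>2 = 2 * real n powr (1 - 2 / enn2real p)"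
  proof -
    have "(real n powr (1/2 - 1 / enn2real p))\<^sup>2 = real n powr (1 - 2 / enn2real p)"
      by (simp add: power2_eq_square flip: powr_add)
    then show ?thesis by (simp add: r_def power_mult_distrib)
  qed
  ultimately show ?thesis
    unfolding cZ_lin_def
    using diag_unitary_Sp[OF n] diag_unitary_lp_ball_subset_cyl[OF n p]
    by (intro Inf_lower) (auto simp: r_def[symmetric] intro!: exI[of _ r])
qed

theorem mainTheorem4:
  "\<exists>A::real. A > 0 \<and>
     (\<forall>(n::nat) (p::ennreal). n \<ge> 1 \<longrightarrow> 1 \<le> p \<longrightarrow>
        cZ_lin n (lp_ball n p) / c_unit_ball
          \<le> ennreal (A * (Vol n (lp_ball n p) / Vol n (ball2n n 1)) powr (1 / real n)))"
proof (intro exI conjI allI impI)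
  show "0 < 2 * exp 1 * pi" by simp
  fix n :: nat and p :: ennreal
  assume n: "n \<ge> 1" and p: "1 \<le> p"
  have "cZ_lin n (lp_ball n p) / c_unit_ball
      \<le> ennreal (pi * (2 * real n powr (1 - 2 / enn2real p))) / ennreal pi"
    unfolding c_unit_ball_def by (intro divide_right_mono_ennreal cZ_lin_lp_ball_le n p)
  also have "\<dots> = ennreal (2 * real n powr (1 - 2 / enn2real p))"
    by (simp add: divide_ennreal)
  also have "\<dots> \<le> ennreal (2 * exp 1 * pi *
      (Vol n (lp_ball n p) / Vol n (ball2n n 1)) powr (1 / real n))"
    using volume_ratio_ge[OF n p] by (intro ennreal_leI) simp
  finally show "cZ_lin n (lp_ball n p) / c_unit_ball \<le> ennreal (2 * exp 1 * pi *
      (Vol n (lp_ball n p) / Vol n (ball2n n 1)) powr (1 / real n))" .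
qed

end
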